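(* Let $f_a=h_a+\overline{g_a}\in K_H$ ($a\in\mathbb{R}$, $|a|<1$) be the right half-plane mapping in $E=\{z\in\mathbb{C}:|z|<1\}$ given by $$h_a(z)=\frac{\frac{1}{1+a}z-\frac12 z^2}{(1-z)^2},\qquad g_a(z)=\frac{\frac{a}{1+a}z-\frac12 z^2}{(1-z)^2}.$$ If $f_n=h+\overline{g}$ is the right half-plane mapping given by $h(z)+g(z)=\frac{z}{1-z}$ with dilatation $\omega(z)=\frac{g'(z)}{h'(z)}=e^{i\theta}z^n$ ($\theta\in\mathbb{R}$, $n\in\mathbb{N}$), then $f_a\ast f_n\in S_H$ and $f_a\ast f_n$ is CHD for $a\in\left[\frac{n-2}{n+2},1\right)$.
   Context: A harmonic mapping in the open unit disk $E$ is written $f=h+\overline{g}$, where $h$ is its analytic part and $g$ its co-analytic part; its dilatation is $\omega=g'/h'$. $S_H$ is the class of all harmonic, sense-preserving and univalent mappings $f=h+\overline g$ in $E$ normalized by $h(0)=0$ and $h_z(0)=1$, so that $f(z)=z+\sum_{k=2}^\infty a_kz^k+\sum_{k=1}^\infty\overline{b_kz^k}$. $K_H$ is the subclass of $S_H$ of functions mapping $E$ onto convex domains. The convolution (Hadamard product) of $F=H+\overline G=z+\sum_{k=2}^\infty A_kz^k+\sum_{k=1}^\infty\overline{B_k}\,\overline z^k$ and $f=h+\overline g=z+\sum_{k=2}^\infty a_kz^k+\sum_{k=1}^\infty\overline{b_k}\,\overline z^k$ is $F\ast f=(H\ast h)+\overline{(G\ast g)}$, obtained by multiplying corresponding coefficients: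 $(F\ast f)(z)=z+\sum_{k=2}^\infty a_kA_kz^k+\sum_{k=1}^\infty\overline{b_kB_k}\,\overline z^k$. A domain is convex in the horizontal direction (CHD) if every line parallel to the real axis has a connected intersection with it; a mapping is called CHD if its image of $E$ is such a domain. The mapping $f_a$ satisfies $h_a+g_a=\frac{z}{1-z}$ and has dilatation $\frac{a-z}{1-az}$.
   Formalization: Since h_a'(0)=1/(1+a), the map f_a*f_n violates the normalization h'(0)=1 of S_H when a≠0; what is proved is that (1+a)(f_a*f_n) is in S_H, while CHD is proved for f_a*f_n itself. *)

theory Defs
  imports "HOL-Complex_Analysis.Complex_Analysis"
begin

abbreviation unit_disk :: "complex set" ("\<E>")
  where "\<E> \<equiv> ball 0 1"

definition harm :: "(complex \<Rightarrow> complex) \<Rightarrow> (complex \<Rightarrow> complex) \<Rightarrow> complex \<Rightarrow> complex"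
  where "harm h g = (\<lambda>z. h z + cnj (g z))"

definition dilatation :: "(complex \<Rightarrow> complex) \<Rightarrow> (complex \<Rightarrow> complex) \<Rightarrow> complex \<Rightarrow> complex"
  where "dilatation h g z = deriv g z / deriv h z"

text \<open>Positivity of the Jacobian, which for \<open>harm h g\<close> is
  \<open>(norm (deriv h z))\<^sup>2 - (norm (deriv g z))\<^sup>2\<close>.\<close>

definition sense_preserving :: "(complex \<Rightarrow> complex) \<Rightarrow> (complex \<Rightarrow> complex) \<Rightarrow> bool"
  where "sense_preserving h g \<longleftrightarrow> (\<forall>z\<in>\<E>. norm (deriv g z) < norm (deriv h z))"

text \<open>The condition \<open>g 0 = 0\<close> reflects that the power series of \<open>g\<close> starts at \<open>k = 1\<close>;
  it makes the decomposition of the mapping unique on the disk.\<close>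

definition S_H :: "(complex \<Rightarrow> complex) set"
  where "S_H = {f. \<exists>h g. h holomorphic_on \<E> \<and> g holomorphic_on \<E> \<and>
                     (\<forall>z\<in>\<E>. f z = harm h g z) \<and>
                     h 0 = 0 \<and> g 0 = 0 \<and> deriv h 0 = 1 \<and>
                     sense_preserving h g \<and> inj_on f \<E>}"

definition K_H :: "(complex \<Rightarrow> complex) set"
  where "K_H = {f \<in> S_H. convex (f ` \<E>)}"

definition hadamard :: "(complex \<Rightarrow> complex) \<Rightarrow> (complex \<Rightarrow> complex) \<Rightarrow> complex \<Rightarrow> complex"
  where "hadamard F f z =
    (\<Sum>k. fps_nth (fps_expansion F 0) k * fps_nth (fps_expansion f 0) k * z ^ k)"

text \<open>The convolution of \<open>harm H G\<close> and \<open>harm h g\<close>.\<close>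

definition harm_conv :: "(complex \<Rightarrow> complex) \<Rightarrow> (complex \<Rightarrow> complex) \<Rightarrow>
    (complex \<Rightarrow> complex) \<Rightarrow> (complex \<Rightarrow> complex) \<Rightarrow> complex \<Rightarrow> complex"
  where "harm_conv H G h g = harm (hadamard H h) (hadamard G g)"

definition CHD_domain :: "complex set \<Rightarrow> bool"
  where "CHD_domain D \<longleftrightarrow> open D \<and> connected D \<and> D \<noteq> {} \<and>
           (\<forall>y. connected (D \<inter> {w. Im w = y}))"

definition CHD :: "(complex \<Rightarrow> complex) \<Rightarrow> bool"
  where "CHD f \<longleftrightarrow> CHD_domain (f ` \<E>)"

definition h_a :: "real \<Rightarrow> complex \<Rightarrow> complex"
  where "h_a a z = (1 / (1 + of_real a) * z - 1 / 2 * z\<^sup>2) / (1 - z)\<^sup>2"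

definition g_a :: "real \<Rightarrow> complex \<Rightarrow> complex"
  where "g_a a z = (of_real a / (1 + of_real a) * z - 1 / 2 * z\<^sup>2) / (1 - z)\<^sup>2"

text \<open>Since \<open>deriv (h_a a) 0 = 1 / (1 + a)\<close>, the mapping \<open>f\<^sub>a\<close> satisfies the normalization of
  \<open>S_H\<close> only after multiplication by the positive constant \<open>1 + a\<close>.  The same holds for its
  convolution with a mapping whose analytic part has derivative 1 at 0.  The rest of this theory
  shows that \<open>f\<^sub>a\<close> so normalized is in \<open>K_H\<close> and that \<open>f\<^sub>a\<close> maps onto a right half-plane.\<close>

lemma cayley:
  assumes "z \<in> \<E>" and w: "w = (1 + z) / (1 - z)" and "\<bar>a\<bar> < 1"
  shows "1 - z \<noteq> 0" "Re w > 0" "z = (w - 1) / (w + 1)"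
    "h_a a z = ((w - 1) / 2 + of_real ((1 - a) / (1 + a)) * (w\<^sup>2 - 1) / 4) / 2"
    "g_a a z = ((w - 1) / 2 - of_real ((1 - a) / (1 + a)) * (w\<^sup>2 - 1) / 4) / 2"
proof -
  have z1: "norm z < 1" using assms by simp
  show nz: "1 - z \<noteq> 0" using z1 by auto
  have na: "1 + complex_of_real a \<noteq> 0"
    using assms(3) by (auto simp: complex_eq_iff)
  have na2: "2 + complex_of_real a * 2 \<noteq> 0"
    using assms(3) by (auto simp: complex_eq_iff)
  have "Re w = (1 - (norm z)\<^sup>2) / (norm (1 - z))\<^sup>2"
    unfolding w cmod_power2 by (simp add: Re_divide power2_eq_square algebra_simps)
  moreover have "(norm z)\<^sup>2 < 1" using z1 by (simp add: power_less_one_iff)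
  ultimately show "Re w > 0" using nz by simp
  have w1: "w + 1 = 2 / (1 - z)" unfolding w using nz by (simp add: field_simps)
  have w2: "w - 1 = 2 * z / (1 - z)" unfolding w using nz by (simp add: field_simps)
  show "z = (w - 1) / (w + 1)" unfolding w1 w2 using nz by simp
  have w3: "w\<^sup>2 - 1 = 4 * z / (1 - z)\<^sup>2"
  proof -
    have "w\<^sup>2 - 1 = (w - 1) * (w + 1)" by (simp add: algebra_simps power2_eq_square)
    then show ?thesis unfolding w1 w2 by (simp add: power2_eq_square)
  qed
  have w4: "w - 1 = 2 * z * (1 - z) / (1 - z)\<^sup>2"
    unfolding w2 using nz by (simp add: power2_eq_square)
  show "h_a a z = ((w - 1) / 2 + of_real ((1 - a) / (1 + a)) * (w\<^sup>2 - 1) / 4) / 2"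
    unfolding w3 unfolding w4 h_a_def using nz na na2
    by (simp add: divide_simps) (simp add: algebra_simps power2_eq_square)
  show "g_a a z = ((w - 1) / 2 - of_real ((1 - a) / (1 + a)) * (w\<^sup>2 - 1) / 4) / 2"
    unfolding w3 unfolding w4 g_a_def using nz na na2
    by (simp add: divide_simps) (simp add: algebra_simps power2_eq_square)
qed

lemma cayley_surj:
  assumes "Re w > 0"
  shows "(w - 1) / (w + 1) \<in> \<E>" "(1 + (w - 1) / (w + 1)) / (1 - (w - 1) / (w + 1)) = w"
proof -
  have nz: "w + 1 \<noteq> 0" using assms by (auto simp: complex_eq_iff)
  have "(norm (w - 1))\<^sup>2 < (norm (w + 1))\<^sup>2"
    unfolding cmod_power2 using assms by (simp add: power2_eq_square algebra_simps)
  then have "norm (w - 1) < norm (w + 1)" by (rule power_less_imp_less_base) simp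
  then show "(w - 1) / (w + 1) \<in> \<E>" using nz by (simp add: norm_divide)
  show "(1 + (w - 1) / (w + 1)) / (1 - (w - 1) / (w + 1)) = w"
    using nz by (simp add: divide_simps)
qed

lemma f_a_eq:
  assumes "z \<in> \<E>" and w: "w = (1 + z) / (1 - z)" and "\<bar>a\<bar> < 1"
  shows "harm (h_a a) (g_a a) z =
    Complex ((Re w - 1) / 2) ((1 - a) / (1 + a) * (Re w * Im w) / 2)"
proof -
  define c where "c = (1 - a) / (1 + a)"
  show ?thesis
    unfolding harm_def cayley(4,5)[OF assms] c_def[symmetric]
    by (simp add: complex_eq_iff power2_eq_square field_simps)
qed

lemma f_a_image:
  assumes a: "\<bar>a\<bar> < 1"
  shows "harm (h_a a) (g_a a) ` \<E> = {w. Re w > - 1 / 2}"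
proof (intro equalityI subsetI)
  fix v assume "v \<in> harm (h_a a) (g_a a) ` \<E>"
  then obtain z where "z \<in> \<E>" "v = harm (h_a a) (g_a a) z" by blast
  then show "v \<in> {w. Re w > - 1 / 2}"
    using f_a_eq[OF _ refl a] cayley(2)[OF _ refl a] by simp
next
  fix v assume "v \<in> {w. Re w > - 1 / 2}"
  then have v: "2 * Re v + 1 > 0" by simp
  define c where "c = (1 - a) / (1 + a)"
  have c: "c > 0" using a by (auto simp: c_def)
  define w where "w = Complex (2 * Re v + 1) (2 * Im v / (c * (2 * Re v + 1)))"
  have "Re w > 0" using v by (simp add: w_def)
  note z = cayley_surj[OF this]
  have "harm (h_a a) (g_a a) ((w - 1) / (w + 1)) = v"
    unfolding f_a_eq[OF z(1) z(2)[symmetric] a] c_def[symmetric]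
    using c v by (simp add: w_def complex_eq_iff)
  then show "v \<in> harm (h_a a) (g_a a) ` \<E>" using z(1) by (metis imageI)
qed

lemma f_a_inj:
  assumes a: "\<bar>a\<bar> < 1"
  shows "inj_on (harm (h_a a) (g_a a)) \<E>"
proof (rule inj_onI)
  fix x y assume xy: "x \<in> \<E>" "y \<in> \<E>" "harm (h_a a) (g_a a) x = harm (h_a a) (g_a a) y"
  define u where "u = (1 + x) / (1 - x)"
  define v where "v = (1 + y) / (1 - y)"
  define c where "c = (1 - a) / (1 + a)"
  have c: "c > 0" using a by (auto simp: c_def)
  have pos: "Re u > 0" using cayley(2)[OF xy(1) u_def a] .
  have "Re u = Re v" "c * (Re u * Im u) = c * (Re v * Im v)"
    using xy(3) unfolding f_a_eq[OF xy(1) u_def a] f_a_eq[OF xy(2) v_def a] c_def by auto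
  then have "u = v" using c pos by (simp add: complex_eq_iff)
  then show "x = y" using cayley(3)[OF xy(1) u_def a] cayley(3)[OF xy(2) v_def a] by simp
qed

lemma f_a_derivs:
  assumes a: "\<bar>a\<bar> < 1" and z: "z \<in> \<E>"
  defines "w \<equiv> (1 + z) / (1 - z)"
  shows "(h_a a has_field_derivative (1 + of_real ((1 - a) / (1 + a)) * w) / (2 * (1 - z)\<^sup>2)) (at z)"
    "(g_a a has_field_derivative (1 - of_real ((1 - a) / (1 + a)) * w) / (2 * (1 - z)\<^sup>2)) (at z)"
proof -
  define c :: complex where "c = of_real ((1 - a) / (1 + a))"
  define W where "W = (\<lambda>z :: complex. (1 + z) / (1 - z))"
  have nz: "1 - z \<noteq> 0" using cayley(1)[OF z refl a] .
  have W: "(W has_field_derivative 2 / (1 - z)\<^sup>2) (at z)"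
    unfolding W_def using nz
    by (auto intro!: derivative_eq_intros simp: power2_eq_square)
  have Wz: "W z = w" by (simp add: W_def w_def)
  have H: "((\<lambda>z. ((W z - 1) / 2 + c * ((W z)\<^sup>2 - 1) / 4) / 2) has_field_derivative
      (1 + c * w) / (2 * (1 - z)\<^sup>2)) (at z)"
    using nz by (auto intro!: derivative_eq_intros W simp: Wz field_simps)
  have G: "((\<lambda>z. ((W z - 1) / 2 - c * ((W z)\<^sup>2 - 1) / 4) / 2) has_field_derivative
      (1 - c * w) / (2 * (1 - z)\<^sup>2)) (at z)"
    using nz by (auto intro!: derivative_eq_intros W simp: Wz field_simps)
  show "(h_a a has_field_derivative (1 + of_real ((1 - a) / (1 + a)) * w) / (2 * (1 - z)\<^sup>2)) (at z)"
    by (rule has_field_derivative_transform_within_open[OF H[unfolded c_def] open_ball z])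
       (simp add: cayley(4)[OF _ refl a] W_def)
  show "(g_a a has_field_derivative (1 - of_real ((1 - a) / (1 + a)) * w) / (2 * (1 - z)\<^sup>2)) (at z)"
    by (rule has_field_derivative_transform_within_open[OF G[unfolded c_def] open_ball z])
       (simp add: cayley(5)[OF _ refl a] W_def)
qed

lemma f_a_in_K_H:
  assumes a: "\<bar>a\<bar> < 1"
  shows "(\<lambda>z. of_real (1 + a) * harm (h_a a) (g_a a) z) \<in> K_H"
proof -
  define c where "c = (1 - a) / (1 + a)"
  have c: "c > 0" using a by (auto simp: c_def)
  have a1: "1 + a > 0" using a by auto
  have na: "1 + complex_of_real a \<noteq> 0" using a by (auto simp: complex_eq_iff)
  define h where "h = (\<lambda>z. of_real (1 + a) * h_a a z)"
  define g where "g = (\<lambda>z. of_real (1 + a) * g_a a z)"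
  have dh: "(h has_field_derivative of_real (1 + a) * ((1 + of_real c * ((1 + z) / (1 - z))) / (2 * (1 - z)\<^sup>2))) (at z)"
    if "z \<in> \<E>" for z
    unfolding h_def c_def by (intro DERIV_cmult f_a_derivs(1)[OF a that])
  have dg: "(g has_field_derivative of_real (1 + a) * ((1 - of_real c * ((1 + z) / (1 - z))) / (2 * (1 - z)\<^sup>2))) (at z)"
    if "z \<in> \<E>" for z
    unfolding g_def c_def by (intro DERIV_cmult f_a_derivs(2)[OF a that])
  have hol: "h holomorphic_on \<E>" "g holomorphic_on \<E>"
    by (meson dh dg holomorphic_on_open open_ball)+
  have fe: "of_real (1 + a) * harm (h_a a) (g_a a) z = harm h g z" for z
    by (simp add: harm_def h_def g_def algebra_simps)
  have "(1 + a) * (1 + c) = 2" using a1 by (simp add: c_def field_simps)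
  then have "complex_of_real (1 + a) * (1 + of_real c) = 2"
    by (metis of_real_1 of_real_add of_real_mult of_real_numeral)
  then have h1: "deriv h 0 = 1"
    using DERIV_imp_deriv[OF dh[of 0]] by simp
  have sp: "sense_preserving h g"
    unfolding sense_preserving_def
  proof
    fix z assume z: "z \<in> \<E>"
    define w where "w = (1 + z) / (1 - z)"
    have nz: "1 - z \<noteq> 0" and w: "Re w > 0" using cayley(1,2)[OF z w_def a] by auto
    have "(norm (1 - of_real c * w))\<^sup>2 < (norm (1 + of_real c * w))\<^sup>2"
      unfolding cmod_power2 using c w by (simp add: power2_eq_square algebra_simps)
    then have "norm (1 - of_real c * w) < norm (1 + of_real c * w)"
      by (rule power_less_imp_less_base) simp
    then show "norm (deriv g z) < norm (deriv h z)"
      unfolding DERIV_imp_deriv[OF dh[OF z]] DERIV_imp_deriv[OF dg[OF z]] w_def[symmetric]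
        norm_mult norm_divide
      using na nz by (intro mult_strict_left_mono divide_strict_right_mono) auto
  qed
  have inj: "inj_on (\<lambda>z. of_real (1 + a) * harm (h_a a) (g_a a) z) \<E>"
    using f_a_inj[OF a] a1 by (auto simp: inj_on_def simp del: of_real_add)
  have "(\<lambda>z. of_real (1 + a) * harm (h_a a) (g_a a) z) ` \<E>
      = (\<lambda>w. (1 + a) *\<^sub>R w) ` {w. Re w > - 1 / 2}"
    unfolding f_a_image[OF a, symmetric] image_image scaleR_conv_of_real ..
  moreover have "convex ((\<lambda>w. (1 + a) *\<^sub>R w) ` {w. Re w > - 1 / 2})"
    using convex_halfspace_Re_gt by (rule convex_scaling)
  ultimately have "convex ((\<lambda>z. of_real (1 + a) * harm (h_a a) (g_a a) z) ` \<E>)" by simp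
  moreover have "h 0 = 0" "g 0 = 0" by (simp_all add: h_def g_def h_a_def g_a_def)
  ultimately show ?thesis
    unfolding K_H_def S_H_def using hol fe h1 sp inj by blast
qed

end

(* With c = (1 - a) / (1 + a) the convolution is harm H G, where H = (h + c z h') / 2 and
   G = (g - c z g') / 2.  Put X = n (1 - \<omega>) / (2 (1 + \<omega>)) + (1 + z) / (1 - z), which has positive
   real part, and m = 1 / c - n / 2.  Then the dilatation of harm H G is \<omega> (m - X) / (m + X), and
   the bound a \<ge> (n - 2) / (n + 2) says exactly m \<ge> 0, so harm H G is sense-preserving.

   In the variable w = (1 + z) / (1 - z) of the right half-plane, the derivative of H - G has real
   part at least (c / 4) Re w.  Hence Im (H - G), which is also the imaginary part of harm H G,
   increases from -\<infinity> to \<infinity> along every vertical line, so each of its level sets is the graph of a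
   continuous function of Re w and is connected.  Parametrized by Re (H - G), each level set is a
   path along which Re (H + G) strictly increases because |G'| < |H'|.  This is the
   shear argument of Clunie and Sheil-Small, and gives both univalence and CHD. *)

theory Submission
  imports Defs
begin

section \<open>Shearing in the right half-plane\<close>

lemma has_real_derivative_Re_line:
  assumes "(f has_field_derivative D) (at (p + of_real s * d))"
  shows "((\<lambda>s. Re (f (p + of_real s * d))) has_real_derivative Re (D * d)) (at s)"
proof -
  have "((\<lambda>s. p + of_real s * d) has_vector_derivative d) (at s)"
    by (auto intro!: derivative_eq_intros)
  from field_vector_diff_chain_at[OF this assms]
  have "((\<lambda>s. f (p + of_real s * d)) has_vector_derivative d * D) (at s)"
    by (simp add: o_def)
  then have "((\<lambda>s. Re (f (p + of_real s * d))) has_vector_derivative Re (d * D)) (at s)"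
    by (rule bounded_linear.has_vector_derivative[OF bounded_linear_Re])
  then show ?thesis
    by (simp add: has_real_derivative_iff_has_vector_derivative mult.commute)
qed

text \<open>The Noshiro-Warschawski criterion. Along the segment from \<open>u\<close> to
  \<open>v\<close>, with \<open>d = v - u\<close>, the function \<open>Re (cnj d * f)\<close> has
  derivative \<open>(norm d)\<^sup>2 * Re (f' w)\<close>, so it strictly increases and
  \<open>f u = f v\<close> is impossible.\<close>

lemma inj_on_Re_deriv_pos:
  assumes "convex S"
    and D: "\<And>w. w \<in> S \<Longrightarrow> (f has_field_derivative f' w) (at w)"
    and pos: "\<And>w. w \<in> S \<Longrightarrow> Re (f' w) > 0"
  shows "inj_on f S"
proof (rule inj_onI, rule ccontr)
  fix u v assume uv: "u \<in> S" "v \<in> S" "f u = f v" "u \<noteq> v"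
  define d where "d = v - u"
  define q where "q = (\<lambda>s. Re (cnj d * f (u + of_real s * d)))"
  have "\<exists>y. (q has_real_derivative y) (at s) \<and> 0 < y" if "0 \<le> s" "s \<le> 1" for s
  proof -
    have "(1 - s) *\<^sub>R u + s *\<^sub>R v \<in> S"
      using \<open>convex S\<close> uv that unfolding convex_def by auto
    then have S: "u + of_real s * d \<in> S"
      by (simp add: d_def scaleR_conv_of_real algebra_simps)
    have "(q has_real_derivative Re (cnj d * f' (u + of_real s * d) * d)) (at s)"
      unfolding q_def by (rule has_real_derivative_Re_line, rule DERIV_cmult, rule D, rule S)
    moreover have "cnj d * f' (u + of_real s * d) * d = of_real ((norm d)\<^sup>2) * f' (u + of_real s * d)"
      using complex_norm_square[of d] by (simp add: mult.commute)
    moreover have "norm d > 0" using uv by (simp add: d_def)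
    ultimately show ?thesis using pos[OF S] by (auto simp del: of_real_power)
  qed
  then have "q 0 < q 1" by (rule DERIV_pos_imp_increasing[OF zero_less_one])
  then show False using uv by (simp add: q_def d_def)
qed

text \<open>The bound \<open>lower\<close> may degenerate at the imaginary axis, but it is constant
  on each vertical line. This forces at least linear growth of \<open>Im (A - B)\<close> there, so
  every level is attained exactly once on every such line.\<close>

lemma shear_half_plane:
  assumes A: "\<And>w. 0 < Re w \<Longrightarrow> (A has_field_derivative A' w) (at w)"
    and B: "\<And>w. 0 < Re w \<Longrightarrow> (B has_field_derivative B' w) (at w)"
    and c: "c > 0"
    and lower: "\<And>w. 0 < Re w \<Longrightarrow> c * Re w \<le> Re (A' w - B' w)"
    and sp: "\<And>w. 0 < Re w \<Longrightarrow> norm (B' w) < norm (A' w)"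
  shows "inj_on (harm A B) {w. 0 < Re w}" (is "inj_on ?F ?R")
    and "CHD_domain (harm A B ` {w. 0 < Re w})"
proof -
  have openR: "open ?R" and convR: "convex ?R" and neR: "?R \<noteq> {}"
    by (auto simp: open_halfspace_Re_gt convex_halfspace_Re_gt intro: exI[of _ 1])
  define \<phi> where "\<phi> = (\<lambda>w. A w - B w)"
  define \<phi>' where "\<phi>' = (\<lambda>w. A' w - B' w)"
  have \<phi>: "(\<phi> has_field_derivative \<phi>' w) (at w)" if "0 < Re w" for w
    unfolding \<phi>_def \<phi>'_def using A B that by (intro DERIV_diff) auto
  have pos: "0 < Re (\<phi>' w)" if "0 < Re w" for w
    using lower[OF that] mult_pos_pos[OF c that] unfolding \<phi>'_def by linarith
  have ImF: "Im (?F w) = Im (\<phi> w)" and ReF: "Re (?F w) = Re (A w + B w)" for w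
    by (simp_all add: harm_def \<phi>_def)
  have cont\<phi>: "continuous_on ?R \<phi>"
    by (rule DERIV_continuous_on) (auto intro: has_field_derivative_at_within \<phi>)
  have contF: "continuous_on ?R ?F"
  proof -
    have "continuous_on ?R A" "continuous_on ?R B"
      by (rule DERIV_continuous_on, auto intro: has_field_derivative_at_within A B)+
    then show ?thesis unfolding harm_def by (intro continuous_intros)
  qed

  define v where "v = (\<lambda>x y. Im (\<phi> (of_real x + of_real y * \<i>)))"
  have dv: "((\<lambda>y. v x y) has_real_derivative Re (\<phi>' (of_real x + of_real y * \<i>))) (at y)"
    if "x > 0" for x y
  proof -
    \<comment> \<open>An imaginary part is the real part after multiplication by
      \<open>- \<i>\<close>. This factor cancels against the direction \<open>\<i>\<close> of the
      line, leaving \<open>Re (\<phi>' w)\<close>.\<close>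
    have "((\<lambda>y. Re (- \<i> * \<phi> (of_real x + of_real y * \<i>))) has_real_derivative
        Re (- \<i> * \<phi>' (of_real x + of_real y * \<i>) * \<i>)) (at y)"
      by (rule has_real_derivative_Re_line, rule DERIV_cmult, rule \<phi>) (use that in simp)
    then show ?thesis by (simp add: v_def)
  qed
  have growth: "c * x * (y2 - y1) \<le> v x y2 - v x y1" if x: "x > 0" and y: "y1 < y2" for x y1 y2
  proof -
    obtain y where "v x y2 - v x y1 = (y2 - y1) * Re (\<phi>' (of_real x + of_real y * \<i>))"
      using MVT2[OF y dv[OF x]] by blast
    moreover have "c * x \<le> Re (\<phi>' (of_real x + of_real y * \<i>))"
      using lower[of "of_real x + of_real y * \<i>"] x by (simp add: \<phi>'_def)
    ultimately show ?thesis using y by (simp add: mult.commute mult_left_mono)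
  qed
  have smono: "v x y1 < v x y2" if "x > 0" "y1 < y2" for x y1 y2
    using growth[OF that] c that by (smt (verit) mult_pos_pos)
  have ex: "\<exists>y. v x y = t" if "x > 0" for x t
  proof -
    \<comment> \<open>By \<open>growth\<close>, moving from 0 by \<open>M\<close> in either
      direction changes \<open>v x\<close> by at least \<open>c * x * M\<close>, which exceeds the
      distance from \<open>v x 0\<close> to \<open>t\<close>. The summand 1 keeps \<open>M\<close>
      positive.\<close>
    define M where "M = \<bar>t - v x 0\<bar> / (c * x) + 1"
    have "\<bar>t - v x 0\<bar> / (c * x) \<ge> 0" using c that by simp
    then have M: "M > 0" by (simp add: M_def)
    have M2: "c * x * M = \<bar>t - v x 0\<bar> + c * x"
      using c that by (simp add: M_def field_simps)
    have "c * x > 0" using c that by simp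
    then have "v x (- M) \<le> t" "t \<le> v x M"
      using growth[of x "-M" 0] growth[of x 0 M] M M2 that by auto
    moreover have "continuous_on {- M..M} (v x)"
      using dv[OF that] by (meson DERIV_isCont continuous_at_imp_continuous_on)
    ultimately show ?thesis using IVT'[of "v x" "-M" t M] M by auto
  qed
  have connL: "connected {w \<in> ?R. Im (\<phi> w) = t}" for t
  proof -
    define Y where "Y = (\<lambda>x. SOME y. v x y = t)"
    have Y: "v x (Y x) = t" if "x > 0" for x
      using someI_ex[OF ex[OF that]] by (simp add: Y_def)
    have contv: "isCont (\<lambda>x. v x y) x" if "x > 0" for x y
    proof -
      have "isCont (\<lambda>x. of_real x + of_real y * \<i>) x" by (intro continuous_intros)
      moreover have "isCont \<phi> (of_real x + of_real y * \<i>)"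
        by (rule DERIV_isCont[OF \<phi>]) (use that in simp)
      ultimately show ?thesis
        unfolding v_def using isCont_o2 by (intro isCont_Im) fast
    qed
    \<comment> \<open>Strict monotonicity in \<open>y\<close> replaces the implicit function
      theorem: the strict inequalities at heights \<open>Y x - e\<close> and \<open>Y x + e\<close>
      persist for nearby \<open>x'\<close> and trap \<open>Y x'\<close> between these
      heights.\<close>
    have "isCont Y x" if x: "x > 0" for x
      unfolding isCont_def tendsto_iff
    proof (intro allI impI)
      fix e :: real assume e: "e > 0"
      have "v x (Y x - e) < t" "t < v x (Y x + e)"
        using smono[OF x, of "Y x - e" "Y x"] smono[OF x, of "Y x" "Y x + e"] Y[OF x] e by auto
      then have "\<forall>\<^sub>F x' in at x. v x' (Y x - e) < t" "\<forall>\<^sub>F x' in at x. t < v x' (Y x + e)"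
        by (auto intro: order_tendstoD[OF contv[OF x, unfolded isCont_def]])
      moreover have "\<forall>\<^sub>F x' in at x. x' > 0"
        using x by (intro order_tendstoD(1)[OF tendsto_ident_at])
      ultimately show "\<forall>\<^sub>F x' in at x. dist (Y x') (Y x) < e"
      proof eventually_elim
        case (elim x')
        have "\<not> Y x' \<le> Y x - e" "\<not> Y x + e \<le> Y x'"
          using smono[OF elim(3)] Y[OF elim(3)] elim by (smt (verit))+
        then show ?case by (simp add: dist_real_def)
      qed
    qed
    then have "continuous_on {0<..} (\<lambda>x. of_real x + of_real (Y x) * \<i>)"
      by (intro continuous_intros continuous_at_imp_continuous_on) auto
    then have "connected ((\<lambda>x. of_real x + of_real (Y x) * \<i>) ` {0<..})"
      by (intro connected_continuous_image) auto
    moreover have "{w \<in> ?R. Im (\<phi> w) = t} = (\<lambda>x. of_real x + of_real (Y x) * \<i>) ` {0<..}"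
    proof (intro equalityI subsetI)
      fix w assume w: "w \<in> {w \<in> ?R. Im (\<phi> w) = t}"
      have we: "w = of_real (Re w) + of_real (Im w) * \<i>" by (simp add: complex_eq_iff)
      have "v (Re w) (Im w) = v (Re w) (Y (Re w))"
        using w Y we by (simp add: v_def)
      then have "Im w = Y (Re w)" 
        using smono[of "Re w" "Im w" "Y (Re w)"] smono[of "Re w" "Y (Re w)" "Im w"] w by fastforce
      then show "w \<in> (\<lambda>x. of_real x + of_real (Y x) * \<i>) ` {0<..}"
        using w we by auto
    next
      fix w assume "w \<in> (\<lambda>x. of_real x + of_real (Y x) * \<i>) ` {0<..}"
      then show "w \<in> {w \<in> ?R. Im (\<phi> w) = t}" using Y by (auto simp: v_def)
    qed
    ultimately show ?thesis by simp
  qed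

  have inj\<phi>: "inj_on \<phi> ?R"
    using convR \<phi> pos by (intro inj_on_Re_deriv_pos[where f' = \<phi>']) auto
  have hol\<phi>: "\<phi> holomorphic_on ?R"
    using \<phi> openR by (auto simp: holomorphic_on_open)
  obtain \<psi> where \<psi>: "\<psi> holomorphic_on (\<phi> ` ?R)"
    "\<And>w. w \<in> ?R \<Longrightarrow> deriv \<phi> w * deriv \<psi> (\<phi> w) = 1" "\<And>w. w \<in> ?R \<Longrightarrow> \<psi> (\<phi> w) = w"
    using holomorphic_has_inverse[OF hol\<phi> openR inj\<phi>] by metis
  have open\<phi>: "open (\<phi> ` ?R)"
    using open_mapping_thm3[OF hol\<phi> openR inj\<phi>] .
  have incr: "Re (?F w1) < Re (?F w2)"
    if w: "w1 \<in> ?R" "w2 \<in> ?R" "Im (\<phi> w1) = Im (\<phi> w2)" "Re (\<phi> w1) < Re (\<phi> w2)" for w1 w2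
  proof -
    define t where "t = Im (\<phi> w1)"
    \<comment> \<open>The factor 1 is the direction of a horizontal line, kept so that the term has
      the form required by \<open>has_real_derivative_Re_line\<close>.\<close>
    have p: "of_real t * \<i> + of_real (Re (\<phi> w)) * 1 = \<phi> w" if "Im (\<phi> w) = t" for w
      using that by (simp add: complex_eq_iff)
    define q where "q = (\<lambda>s. Re (A (\<psi> (of_real t * \<i> + of_real s * 1)) + B (\<psi> (of_real t * \<i> + of_real s * 1))))"
    \<comment> \<open>Connectedness of the level set puts the whole horizontal segment from
      \<open>\<phi> w1\<close> to \<open>\<phi> w2\<close> inside the image of
      \<open>\<phi>\<close>, so the inverse \<open>\<psi>\<close> can be followed along it.\<close>
    have "connected ((\<lambda>w. Re (\<phi> w)) ` {w \<in> ?R. Im (\<phi> w) = t})"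
      by (intro connected_continuous_image connL continuous_intros continuous_on_subset[OF cont\<phi>]) auto
    then have iv: "\<exists>w \<in> ?R. Im (\<phi> w) = t \<and> Re (\<phi> w) = s"
      if "Re (\<phi> w1) \<le> s" "s \<le> Re (\<phi> w2)" for s
      using connectedD_interval[of _ "Re (\<phi> w1)" "Re (\<phi> w2)" s] w that
      by (auto simp: t_def image_iff)
    have "\<exists>y. (q has_real_derivative y) (at s) \<and> 0 < y"
      if s: "Re (\<phi> w1) \<le> s" "s \<le> Re (\<phi> w2)" for s
    proof -
      obtain w where w: "w \<in> ?R" "Im (\<phi> w) = t" "Re (\<phi> w) = s"
        using iv[OF s] by blast
      have ps: "of_real t * \<i> + of_real s * 1 = \<phi> w" using p[OF w(2)] w(3) by simp
      have d\<phi>: "deriv \<phi> w = \<phi>' w" using \<phi> w by (auto intro: DERIV_imp_deriv)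
      have nz: "\<phi>' w \<noteq> 0" using pos[of w] w by auto
      have "deriv \<psi> (\<phi> w) = 1 / \<phi>' w" using \<psi>(2)[OF w(1)] nz by (simp add: d\<phi> field_simps)
      then have "(\<psi> has_field_derivative 1 / \<phi>' w) (at (\<phi> w))"
        using holomorphic_derivI[OF \<psi>(1) open\<phi>] w by (metis imageI)
      moreover have "((\<lambda>w. A w + B w) has_field_derivative (A' w + B' w)) (at (\<psi> (\<phi> w)))"
        unfolding \<psi>(3)[OF w(1)] using w by (intro DERIV_add A B) auto
      ultimately have "((\<lambda>u. A (\<psi> u) + B (\<psi> u)) has_field_derivative (A' w + B' w) * (1 / \<phi>' w)) (at (\<phi> w))"
        by (rule DERIV_chain2[rotated])
      then have "(q has_real_derivative Re ((A' w + B' w) * (1 / \<phi>' w) * 1)) (at s)"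
        unfolding q_def ps[symmetric] by (rule has_real_derivative_Re_line)
      \<comment> \<open>Expand the quotient with \<open>cnj (A' w - B' w)\<close>: the mixed terms
        of the numerator form a purely imaginary number.\<close>
      moreover have "Re ((A' w + B' w) * (1 / \<phi>' w) * 1) = ((norm (A' w))\<^sup>2 - (norm (B' w))\<^sup>2) / (norm (\<phi>' w))\<^sup>2"
        unfolding cmod_power2 \<phi>'_def
        by (simp add: Re_divide power2_eq_square algebra_simps)
      moreover have "(norm (B' w))\<^sup>2 < (norm (A' w))\<^sup>2"
        using sp[of w] w by (intro power_strict_mono) auto
      ultimately show ?thesis using nz by auto
    qed
    then have "q (Re (\<phi> w1)) < q (Re (\<phi> w2))"
      by (rule DERIV_pos_imp_increasing[OF w(4)])
    then show ?thesis
      unfolding q_def using p[of w1] p[of w2] w \<psi>(3) by (simp add: ReF t_def)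
  qed
  show injF: "inj_on ?F ?R"
  proof (rule inj_onI)
    fix w1 w2 assume w: "w1 \<in> ?R" "w2 \<in> ?R" "?F w1 = ?F w2"
    have "Im (\<phi> w1) = Im (\<phi> w2)" using ImF w(3) by metis
    moreover have "Re (\<phi> w1) = Re (\<phi> w2)"
      using incr[of w1 w2] incr[of w2 w1] w calculation by (metis less_irrefl linorder_neqE)
    ultimately have "\<phi> w1 = \<phi> w2" by (rule complex_eqI[rotated])
    then show "w1 = w2" using inj_onD[OF inj\<phi>] w(1,2) by blast
  qed
  have "?F ` ?R \<inter> {w. Im w = y} = ?F ` {w \<in> ?R. Im (\<phi> w) = y}" for y
    using ImF by auto
  moreover have "connected (?F ` {w \<in> ?R. Im (\<phi> w) = y})" for y
    by (intro connected_continuous_image connL continuous_on_subset[OF contF]) auto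
  \<comment> \<open>The harmonic map need not be holomorphic, so openness comes from continuity and
    injectivity.\<close>
  moreover have "open (?F ` ?R)"
    by (rule invariance_of_domain[OF contF openR injF])
  moreover have "connected (?F ` ?R)"
    by (intro connected_continuous_image contF convex_connected convR)
  ultimately show "CHD_domain (?F ` ?R)"
    unfolding CHD_domain_def using neR by auto
qed

section \<open>Convolution with the half-plane kernels\<close>

text \<open>Among functions vanishing at 0, \<open>z / (1 - z)\<close> is the identity for the
  convolution, and the Koebe function \<open>z / (1 - z)\<^sup>2\<close>, with coefficients
  \<open>k\<close>, acts as \<open>z\<close> times the derivative.\<close>

lemma hadamard_derivation:
  assumes F: "\<And>z. z \<in> \<E> \<Longrightarrow> F z = (z / (1 - z) + c * z / (1 - z)\<^sup>2) / 2"
    and f: "f holomorphic_on \<E>" "f 0 = 0" and z: "z \<in> \<E>"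
  shows "hadamard F f z = (f z + c * z * deriv f z) / 2"
proof -
  \<comment> \<open>At \<open>k = 0\<close> the formula \<open>(1 + c * k) / 2\<close> would give
    1/2, while \<open>F 0 = 0\<close>. In the final comparison of terms the index 0 contributes
    nothing because \<open>f 0 = 0\<close>.\<close>
  have "F has_fps_expansion Abs_fps (\<lambda>k. if k = 0 then 0 else (1 + c * of_nat k) / 2)"
  proof (rule has_fps_expansionI, rule eventually_nhds_in_open[THEN eventually_mono])
    fix u :: complex assume u: "u \<in> \<E>"
    then have u1: "norm u < 1" "1 - u \<noteq> 0" by auto
    have "(\<lambda>k. (u * u ^ k + c * u * (of_nat (Suc k) * u ^ k)) / 2) sums
        ((u * (1 / (1 - u)) + c * u * (1 / (1 - u)\<^sup>2)) / 2)"
      by (intro sums_divide sums_add sums_mult geometric_sums geometric_deriv_sums u1)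
    then have "(\<lambda>k. (if Suc k = 0 then 0 else (1 + c * of_nat (Suc k)) / 2) * u ^ Suc k) sums F u"
      by (simp add: F[OF u] algebra_simps add_divide_distrib)
    then show "(\<lambda>k. fps_nth (Abs_fps (\<lambda>k. if k = 0 then 0 else (1 + c * of_nat k) / 2)) k * u ^ k) sums F u"
      by (subst (asm) sums_Suc_iff) simp
  qed auto
  then have coeffF: "fps_expansion F 0 = Abs_fps (\<lambda>k. if k = 0 then 0 else (1 + c * of_nat k) / 2)"
    by (auto intro!: fps_ext simp: fps_expansion_def fps_nth_fps_expansion[symmetric])
  define b where "b = (\<lambda>k. fps_nth (fps_expansion f 0) k)"
  have b: "b k = (deriv ^^ k) f 0 / fact k" for k
    by (simp add: b_def fps_expansion_def)
  have s1: "(\<lambda>k. b k * z ^ k) sums f z"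
    using holomorphic_power_series[OF f(1) z] by (simp add: b)
  have "(\<lambda>k. (deriv ^^ k) (deriv f) 0 / fact k * (z - 0) ^ k) sums deriv f z"
    by (rule holomorphic_power_series[OF holomorphic_deriv[OF f(1) open_ball] z])
  moreover have "(deriv ^^ k) (deriv f) 0 / fact k = of_nat (Suc k) * b (Suc k)" for k
    unfolding b by (simp add: funpow_swap1 del: of_nat_Suc funpow.simps) (simp add: funpow_swap1)
  ultimately have "(\<lambda>k. of_nat (Suc k) * b (Suc k) * z ^ k) sums deriv f z" by simp
  then have "(\<lambda>k. z * (of_nat (Suc k) * b (Suc k) * z ^ k)) sums (z * deriv f z)"
    by (rule sums_mult)
  then have "(\<lambda>k. of_nat (Suc k) * b (Suc k) * z ^ Suc k) sums (z * deriv f z)"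
    by (simp add: algebra_simps)
  then have s2: "(\<lambda>k. of_nat k * b k * z ^ k) sums (z * deriv f z)"
    by (subst (asm) sums_Suc_iff) simp
  have "(\<lambda>k. (b k * z ^ k + c * (of_nat k * b k * z ^ k)) / 2) sums ((f z + c * (z * deriv f z)) / 2)"
    by (intro sums_divide sums_add sums_mult s1 s2)
  moreover have "(b k * z ^ k + c * (of_nat k * b k * z ^ k)) / 2 =
      fps_nth (fps_expansion F 0) k * fps_nth (fps_expansion f 0) k * z ^ k" for k
    using f(2) b[of 0] by (simp add: coeffF b_def[symmetric] algebra_simps)
  ultimately show ?thesis
    unfolding hadamard_def by (simp add: sums_iff mult.assoc)
qed

section \<open>Transfer of the shear to the unit disk\<close>

lemma cayley_inverse_image: "(\<lambda>w. (w - 1) / (w + 1)) ` {w. 0 < Re w} = \<E>"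
proof (intro equalityI subsetI)
  fix z assume z: "z \<in> \<E>"
  show "z \<in> (\<lambda>w. (w - 1) / (w + 1)) ` {w. 0 < Re w}"
    using cayley(2,3)[OF z refl, of 0] by auto
qed (use cayley_surj(1) in auto)

text \<open>The substitution \<open>z = (w - 1) / (w + 1)\<close> has derivative
  \<open>2 / (w + 1)\<^sup>2\<close>, which equals \<open>(1 - z)\<^sup>2 / 2\<close>. This is the
  source of the weight \<open>(1 - z)\<^sup>2\<close> in \<open>lower\<close> and of the constant
  \<open>c / 2\<close> on the half-plane.\<close>

lemma shear_unit_disk:
  assumes H: "\<And>z. z \<in> \<E> \<Longrightarrow> (H has_field_derivative H' z) (at z)"
    and G: "\<And>z. z \<in> \<E> \<Longrightarrow> (G has_field_derivative G' z) (at z)"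
    and c: "c > 0"
    and lower: "\<And>z. z \<in> \<E> \<Longrightarrow> c * Re ((1 + z) / (1 - z)) \<le> Re ((1 - z)\<^sup>2 * (H' z - G' z))"
    and sp: "\<And>z. z \<in> \<E> \<Longrightarrow> norm (G' z) < norm (H' z)"
  shows "inj_on (harm H G) \<E>" and "CHD (harm H G)"
proof -
  define \<kappa> :: "complex \<Rightarrow> complex" where "\<kappa> = (\<lambda>w. (w - 1) / (w + 1))"
  have \<kappa>E: "\<kappa> w \<in> \<E>" and \<kappa>w: "(1 + \<kappa> w) / (1 - \<kappa> w) = w" and nz: "w + 1 \<noteq> 0"
    if "0 < Re w" for w
    using cayley_surj[OF that] that by (auto simp: \<kappa>_def complex_eq_iff)
  have d\<kappa>: "(\<kappa> has_field_derivative 2 / (w + 1)\<^sup>2) (at w)" if "0 < Re w" for w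
    unfolding \<kappa>_def using nz[OF that]
    by (auto intro!: derivative_eq_intros simp: power2_eq_square)
  have im: "\<kappa> ` {w. 0 < Re w} = \<E>"
    unfolding \<kappa>_def by (rule cayley_inverse_image)
  note facts = shear_half_plane[where A = "\<lambda>w. H (\<kappa> w)" and B = "\<lambda>w. G (\<kappa> w)"
      and A' = "\<lambda>w. H' (\<kappa> w) * (2 / (w + 1)\<^sup>2)" and B' = "\<lambda>w. G' (\<kappa> w) * (2 / (w + 1)\<^sup>2)"
      and c = "c / 2"]
  have 1: "((\<lambda>w. H (\<kappa> w)) has_field_derivative H' (\<kappa> w) * (2 / (w + 1)\<^sup>2)) (at w)"
    and 2: "((\<lambda>w. G (\<kappa> w)) has_field_derivative G' (\<kappa> w) * (2 / (w + 1)\<^sup>2)) (at w)"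
    if "0 < Re w" for w
    by (rule DERIV_chain2[OF H[OF \<kappa>E[OF that]] d\<kappa>[OF that]])
       (rule DERIV_chain2[OF G[OF \<kappa>E[OF that]] d\<kappa>[OF that]])
  have 3: "c / 2 * Re w \<le> Re (H' (\<kappa> w) * (2 / (w + 1)\<^sup>2) - G' (\<kappa> w) * (2 / (w + 1)\<^sup>2))"
    if w: "0 < Re w" for w
  proof -
    have "1 - \<kappa> w = 2 / (w + 1)" using nz[OF w] by (simp add: \<kappa>_def field_simps)
    then have e: "2 / (w + 1)\<^sup>2 = (1 - \<kappa> w)\<^sup>2 / 2"
      by (simp add: power_divide)
    have eq: "H' (\<kappa> w) * (2 / (w + 1)\<^sup>2) - G' (\<kappa> w) * (2 / (w + 1)\<^sup>2)
        = ((1 - \<kappa> w)\<^sup>2 * (H' (\<kappa> w) - G' (\<kappa> w))) / 2"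
      unfolding e by (simp add: algebra_simps diff_divide_distrib)
    show ?thesis unfolding eq using lower[OF \<kappa>E[OF w]] by (simp add: \<kappa>w[OF w])
  qed
  have 4: "norm (G' (\<kappa> w) * (2 / (w + 1)\<^sup>2)) < norm (H' (\<kappa> w) * (2 / (w + 1)\<^sup>2))"
    if "0 < Re w" for w
    unfolding norm_mult using sp[OF \<kappa>E[OF that]] nz[OF that]
    by (intro mult_strict_right_mono) auto
  have harm: "harm (\<lambda>w. H (\<kappa> w)) (\<lambda>w. G (\<kappa> w)) = harm H G \<circ> \<kappa>"
    by (simp add: harm_def fun_eq_iff)
  have "inj_on (harm H G \<circ> \<kappa>) {w. 0 < Re w}"
    using facts(1)[OF 1 2 _ 3 4] c unfolding harm by simp
  then show "inj_on (harm H G) \<E>"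
    using inj_on_imageI im by metis
  show "CHD (harm H G)"
    using facts(2)[OF 1 2 _ 3 4] c unfolding harm CHD_def im[symmetric] image_comp by simp
qed

section \<open>The kernels, the Cayley quotient and the dilatation\<close>

text \<open>Brings both parts into the shape that \<open>hadamard_derivation\<close> expects; they
  differ only in the sign of \<open>c\<close>.\<close>

lemma h_a_g_a_eq:
  assumes "\<bar>a\<bar> < 1" and "z \<in> \<E>"
  defines "c \<equiv> complex_of_real ((1 - a) / (1 + a))"
  shows "h_a a z = (z / (1 - z) + c * z / (1 - z)\<^sup>2) / 2"
    and "g_a a z = (z / (1 - z) + (- c) * z / (1 - z)\<^sup>2) / 2"
proof -
  define W where "W = (1 + z) / (1 - z)"
  have nz: "1 - z \<noteq> 0" using cayley(1)[OF assms(2) refl assms(1)] .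
  have W1: "(W - 1) / 2 = z / (1 - z)" "(W + 1) / 2 = 1 / (1 - z)"
    unfolding W_def using nz by (simp_all add: field_simps)
  have "(W\<^sup>2 - 1) / 4 = ((W - 1) / 2) * ((W + 1) / 2)"
    by (simp add: power2_eq_square algebra_simps)
  then have W2: "(W\<^sup>2 - 1) / 4 = z / (1 - z)\<^sup>2"
    unfolding W1 by (simp add: power2_eq_square)
  have cW: "c * (W\<^sup>2 - 1) / 4 = c * z / (1 - z)\<^sup>2"
    using arg_cong[OF W2, of "(*) c"] by simp
  show "h_a a z = (z / (1 - z) + c * z / (1 - z)\<^sup>2) / 2"
    and "g_a a z = (z / (1 - z) + (- c) * z / (1 - z)\<^sup>2) / 2"
    unfolding cayley(4,5)[OF assms(2) W_def assms(1), folded c_def] W1 cW by simp_all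
qed

lemma Re_cayley_half_pos:
  assumes "norm \<omega> < 1"
  shows "1 + \<omega> \<noteq> 0" and "Re ((1 - \<omega>) / (2 * (1 + \<omega>))) > 0"
proof -
  have "- \<omega> \<in> \<E>" using assms by simp
  from cayley(1,2)[OF this refl, of 0]
  have "1 + \<omega> \<noteq> 0" "Re ((1 - \<omega>) / (1 + \<omega>)) > 0" by simp_all
  moreover have half: "(1 - \<omega>) / (2 * (1 + \<omega>)) = of_real (1 / 2) * ((1 - \<omega>) / (1 + \<omega>))" by simp
  ultimately show "1 + \<omega> \<noteq> 0" and "Re ((1 - \<omega>) / (2 * (1 + \<omega>))) > 0"
    unfolding half by (simp_all only: Re_complex_of_real times_complex.sel) simp_all
qed

lemma deriv_of_dilatation:
  assumes hol: "h holomorphic_on \<E>" "g holomorphic_on \<E>"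
    and \<omega>: "continuous_on \<E> \<omega>" "\<And>z. z \<in> \<E> \<Longrightarrow> z \<noteq> 0 \<Longrightarrow> \<omega> z \<noteq> 0"
    and dil: "\<And>z. z \<in> \<E> \<Longrightarrow> dilatation h g z = \<omega> z"
    and z: "z \<in> \<E>"
  shows "deriv g z = \<omega> z * deriv h z"
proof -
  \<comment> \<open>If \<open>deriv h u\<close> were 0, the quotient would be 0 by convention, which
    the nonvanishing of \<open>\<omega> u\<close> excludes.\<close>
  have off: "deriv g u - \<omega> u * deriv h u = 0" if "u \<in> \<E>" "u \<noteq> 0" for u
    using \<omega>(2)[OF that] dil[OF that(1)]
    by (cases "deriv h u = 0") (auto simp: dilatation_def field_simps)
  \<comment> \<open>At 0, where \<open>\<omega>\<close> may vanish, the quotient could be the junk value 0 of a division by 0,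
    so there the identity comes from continuity.\<close>
  define k where "k = (\<lambda>u. deriv g u - \<omega> u * deriv h u)"
  have "continuous_on \<E> k"
    unfolding k_def
    by (intro continuous_intros holomorphic_on_imp_continuous_on holomorphic_deriv hol \<omega>(1) open_ball)
  then have "(k \<longlongrightarrow> k 0) (at 0)"
    by (simp add: continuous_on_eq_continuous_at isCont_def)
  moreover have "\<forall>\<^sub>F u in at 0. k u = 0"
    by (rule eventually_mono[OF eventually_at_ball'[OF zero_less_one]]) (use off in \<open>auto simp: k_def\<close>)
  then have "(k \<longlongrightarrow> 0) (at 0)" by (rule tendsto_eventually)
  ultimately have "k 0 = 0" by (rule tendsto_unique[rotated]) simp
  then show ?thesis using off[OF z] by (cases "z = 0") (auto simp: k_def)
qed

section \<open>The convolution of the two half-plane mappings\<close>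

theorem theorem2p2:
  fixes a \<theta> :: real and n :: nat and h g :: "complex \<Rightarrow> complex"
  assumes "\<bar>a\<bar> < 1"
    and "n \<ge> 1"
    and "h holomorphic_on \<E>" and "g holomorphic_on \<E>"
    and "h 0 = 0" and "g 0 = 0"
    and "\<And>z. z \<in> \<E> \<Longrightarrow> h z + g z = z / (1 - z)"
    and "\<And>z. z \<in> \<E> \<Longrightarrow> dilatation h g z = exp (\<i> * of_real \<theta>) * z ^ n"
    and "a \<in> {(real n - 2) / (real n + 2)..<1}"
  shows "(\<lambda>z. of_real (1 + a) * harm_conv (h_a a) (g_a a) h g z) \<in> S_H
         \<and> CHD (harm_conv (h_a a) (g_a a) h g)"
proof -
  note a = assms(1) and n = assms(2) and hol = assms(3,4)
  define c where "c = (1 - a) / (1 + a)"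
  define m where "m = 1 / c - real n / 2"
  have a1: "1 + a > 0" and na: "complex_of_real (1 + a) \<noteq> 0" using a by (auto simp del: of_real_add)
  have c: "c > 0" using a by (auto simp: c_def)
  \<comment> \<open>Since \<open>1 / c = (1 + a) / (1 - a)\<close>, this is the lower bound on
    \<open>a\<close> cleared of denominators.\<close>
  have m: "m \<ge> 0"
  proof -
    have "real n - 2 \<le> a * (real n + 2)" using assms(9) by (simp add: divide_le_eq)
    then have "n * (1 - a) \<le> 2 * (1 + a)" by (simp add: algebra_simps)
    then show ?thesis using a unfolding m_def c_def by (simp add: field_simps)
  qed
  have cm: "of_real c * (of_real m + of_nat n / 2) = (1 :: complex)"
    using c by (simp add: m_def field_simps)
  have cm': "of_real c * of_real m = (1 :: complex) - of_real c * of_nat n / 2"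
    using cm by (simp add: algebra_simps)
  define \<omega> where "\<omega> = (\<lambda>z. exp (\<i> * of_real \<theta>) * z ^ n)"
  have \<omega>1: "norm (\<omega> z) < 1" if "z \<in> \<E>" for z
    using that n by (simp add: \<omega>_def norm_mult norm_power power_less_one_iff)
  define \<omega>' where "\<omega>' = (\<lambda>z. exp (\<i> * of_real \<theta>) * (of_nat n * z ^ (n - 1)))"
  have d\<omega>: "(\<omega> has_field_derivative \<omega>' z) (at z)" for z
    unfolding \<omega>_def \<omega>'_def by (auto intro!: derivative_eq_intros)
  have z\<omega>': "z * \<omega>' z = of_nat n * \<omega> z" for z
    using n by (cases n) (simp_all add: \<omega>_def \<omega>'_def)
  have nz: "1 - z \<noteq> 0" if "z \<in> \<E>" for z :: complex
    using that by auto

  have g': "deriv g z = \<omega> z * deriv h z" if "z \<in> \<E>" for z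
    using assms(8) that by (intro deriv_of_dilatation hol) (auto simp: \<omega>_def intro!: continuous_intros)
  have dh: "(h has_field_derivative deriv h z) (at z)"
    and dg: "(g has_field_derivative deriv g z) (at z)"
    and ddh: "(deriv h has_field_derivative deriv (deriv h) z) (at z)" if "z \<in> \<E>" for z
    using that by (auto intro!: holomorphic_derivI[of _ \<E>] holomorphic_deriv hol)
  \<comment> \<open>Differentiate \<open>h + g\<close> and insert \<open>g'\<close>. The product
    form also shows that \<open>deriv h z\<close> is nonzero, and it is differentiated again below
    to reach the second derivative.\<close>
  have h': "deriv h z * (1 + \<omega> z) * (1 - z)\<^sup>2 = 1" if z: "z \<in> \<E>" for z
  proof -
    have "((\<lambda>z. z / (1 - z)) has_field_derivative 1 / (1 - z)\<^sup>2) (at z)"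
      using nz[OF z] by (auto intro!: derivative_eq_intros simp: power2_eq_square field_simps)
    moreover have "((\<lambda>z. z / (1 - z)) has_field_derivative deriv h z + deriv g z) (at z)"
      using DERIV_add[OF dh[OF z] dg[OF z]] open_ball z assms(7)
      by (rule has_field_derivative_transform_within_open)
    ultimately have "deriv h z + deriv g z = 1 / (1 - z)\<^sup>2" by (rule DERIV_unique[rotated])
    then show ?thesis using nz[OF z] g'[OF z] by (simp add: field_simps)
  qed

  define H where "H = (\<lambda>z. (h z + of_real c * z * deriv h z) / 2)"
  define G where "G = (\<lambda>z. (g z + (- of_real c) * z * deriv g z) / 2)"
  \<comment> \<open>Where \<open>X\<close> comes from: logarithmic differentiation of
    \<open>h'\<close> gives \<open>1 + z * deriv (deriv h) z / deriv h z = X z - n / 2\<close>. Thus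
    \<open>z * deriv h z\<close> has derivative \<open>deriv h z * (X z - n / 2)\<close>, and
    \<open>z * deriv g z\<close> has derivative
    \<open>\<omega> z * deriv h z * (X z + n / 2)\<close>, the shift by \<open>n\<close> being due
    to \<open>z\<omega>'\<close>. With \<open>c * (m + n / 2) = 1\<close> these yield
    \<open>H'\<close> and \<open>G'\<close>.\<close>
  define X where "X = (\<lambda>z. of_nat n * ((1 - \<omega> z) / (2 * (1 + \<omega> z))) + (1 + z) / (1 - z))"
  define H' where "H' = (\<lambda>z. of_real c / 2 * deriv h z * (of_real m + X z))"
  define G' where "G' = (\<lambda>z. of_real c / 2 * deriv h z * (\<omega> z * (of_real m - X z)))"
  have dH: "(H has_field_derivative H' z) (at z)" and dG: "(G has_field_derivative G' z) (at z)"
    if z: "z \<in> \<E>" for z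
  proof -
    note n1 = nz[OF z] and n2 = Re_cayley_half_pos(1)[OF \<omega>1[OF z]]
    define p where "p = (1 - \<omega> z) / (2 * (1 + \<omega> z))"
    define r where "r = 2 * z / (1 - z)"
    have X: "X z = of_nat n * p + 1 + r"
      unfolding X_def p_def[symmetric] r_def using n1 by (simp add: field_simps)
    \<comment> \<open>The function differentiated here is constantly 1 on the disk by
      \<open>h'\<close>. Comparing both derivatives and cancelling one factor \<open>1 - z\<close>
      determines the second derivative of \<open>h\<close>.\<close>
    have "((\<lambda>z. deriv h z * (1 + \<omega> z) * (1 - z)\<^sup>2) has_field_derivative
        (deriv (deriv h) z * (1 + \<omega> z) + deriv h z * \<omega>' z) * (1 - z)\<^sup>2
        - deriv h z * (1 + \<omega> z) * (2 * (1 - z))) (at z)"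
      by (auto intro!: derivative_eq_intros ddh[OF z] d\<omega> simp: algebra_simps)
    moreover have "((\<lambda>z. deriv h z * (1 + \<omega> z) * (1 - z)\<^sup>2) has_field_derivative 0) (at z)"
      by (rule has_field_derivative_transform_within_open[OF DERIV_const[of 1] open_ball z])
        (simp add: h')
    ultimately have "(deriv (deriv h) z * (1 + \<omega> z) + deriv h z * \<omega>' z) * (1 - z)\<^sup>2
        - deriv h z * (1 + \<omega> z) * (2 * (1 - z)) = 0"
      by (rule DERIV_unique)
    moreover have "(deriv (deriv h) z * (1 + \<omega> z) + deriv h z * \<omega>' z) * (1 - z)\<^sup>2
        - deriv h z * (1 + \<omega> z) * (2 * (1 - z))
        = (1 - z) * ((deriv (deriv h) z * (1 + \<omega> z) + deriv h z * \<omega>' z) * (1 - z)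
        - deriv h z * (1 + \<omega> z) * 2)"
      by (simp add: algebra_simps power2_eq_square)
    ultimately have "(deriv (deriv h) z * (1 + \<omega> z) + deriv h z * \<omega>' z) * (1 - z)
        - deriv h z * (1 + \<omega> z) * 2 = 0"
      using n1 by simp
    then have "(deriv (deriv h) z * (1 + \<omega> z) + deriv h z * \<omega>' z) * (1 - z)
        = deriv h z * (1 + \<omega> z) * 2"
      by (rule eq_iff_diff_eq_0[THEN iffD2])
    then have "(z * deriv (deriv h) z * (1 + \<omega> z) + deriv h z * (z * \<omega>' z)) * (1 - z)
        = deriv h z * (1 + \<omega> z) * (2 * z)"
      by algebra
    then have "z * deriv (deriv h) z = deriv h z * (r - of_nat n * (\<omega> z / (1 + \<omega> z)))"
      unfolding z\<omega>' r_def using n1 n2 by (simp add: divide_simps) (simp add: algebra_simps)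
    moreover have "\<omega> z / (1 + \<omega> z) = 1 / 2 - p"
    proof -
      have "2 + \<omega> z * 2 = 2 * (1 + \<omega> z)" by simp
      then have "2 + \<omega> z * 2 \<noteq> 0" using n2 by (metis mult_eq_0_iff zero_neq_numeral)
      then show ?thesis
        unfolding p_def using n2 by (simp add: divide_simps) (simp add: algebra_simps)
    qed
    ultimately have q: "z * deriv (deriv h) z = deriv h z * (r - of_nat n * (1 / 2 - p))"
      by simp
    have "(H has_field_derivative (deriv h z + of_real c * (deriv h z + z * deriv (deriv h) z)) / 2) (at z)"
      unfolding H_def
      by (rule DERIV_cdivide) (auto intro!: derivative_eq_intros ddh[OF z] dh[OF z] simp: algebra_simps)
    moreover have "(deriv h z + of_real c * (deriv h z + z * deriv (deriv h) z)) / 2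
        = deriv h z / 2 * (of_real c * of_real m + of_real c * X z)"
      unfolding q X cm' by (simp add: field_simps)
    moreover have "\<dots> = H' z" by (simp add: H'_def algebra_simps)
    ultimately show "(H has_field_derivative H' z) (at z)" by simp
    have ddg: "(deriv g has_field_derivative \<omega>' z * deriv h z + deriv (deriv h) z * \<omega> z) (at z)"
      by (rule has_field_derivative_transform_within_open[OF DERIV_mult[OF d\<omega> ddh[OF z]] open_ball z])
        (simp add: g')
    have "(G has_field_derivative (deriv g z - of_real c * (deriv g z
        + z * (\<omega>' z * deriv h z + deriv (deriv h) z * \<omega> z))) / 2) (at z)"
      unfolding G_def
      by (rule DERIV_cdivide) (auto intro!: derivative_eq_intros ddg dg[OF z] simp: algebra_simps)
    moreover have "(deriv g z - of_real c * (deriv g z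
        + z * (\<omega>' z * deriv h z + deriv (deriv h) z * \<omega> z))) / 2
        = \<omega> z * (deriv h z - of_real c * (deriv h z
        + (of_nat n * deriv h z + z * deriv (deriv h) z))) / 2"
      using z\<omega>'[of z] unfolding g'[OF z] by algebra
    moreover have "\<dots> = \<omega> z * (deriv h z / 2 * (of_real c * of_real m - of_real c * X z))"
      unfolding q X cm' by (simp add: field_simps)
    moreover have "\<dots> = G' z" by (simp add: G'_def algebra_simps)
    ultimately show "(G has_field_derivative G' z) (at z)" by simp
  qed
  have ReX: "Re (X z) > 0" if z: "z \<in> \<E>" for z
  proof -
    have "Re (X z) = real n * Re ((1 - \<omega> z) / (2 * (1 + \<omega> z))) + Re ((1 + z) / (1 - z))"
      unfolding X_def
      by (simp only: plus_complex.sel times_complex.sel complex_Re_of_nat complex_Im_of_nat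
          mult_zero_left diff_zero)
    then show ?thesis
      using Re_cayley_half_pos(2)[OF \<omega>1[OF z]] cayley(2)[OF z refl a]
      by (smt (verit) mult_nonneg_nonneg of_nat_0_le_iff)
  qed
  have sp: "norm (G' z) < norm (H' z)" if z: "z \<in> \<E>" for z
  proof -
    \<comment> \<open>The two squares differ by \<open>4 * m * Re (X z)\<close>, which vanishes if
      \<open>m = 0\<close>. Strictness therefore comes from \<open>norm (\<omega> z) < 1\<close>
      together with \<open>of_real m + X z\<close> being nonzero.\<close>
    have "(norm (of_real m - X z))\<^sup>2 \<le> (norm (of_real m + X z))\<^sup>2"
      unfolding cmod_power2 using m ReX[OF z] by (simp add: power2_eq_square algebra_simps)
    then have le: "norm (of_real m - X z) \<le> norm (of_real m + X z)"
      by (rule power2_le_imp_le) simp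
    have "Re (of_real m + X z) > 0" using m ReX[OF z] by simp
    then have "norm (of_real m + X z) > 0" by (metis less_irrefl zero_complex.simps(1) zero_less_norm_iff)
    then have "norm (\<omega> z) * norm (of_real m - X z) < norm (of_real m + X z)"
      using \<omega>1[OF z] le by (smt (verit) mult_le_cancel_right1 mult_less_cancel_right1 norm_ge_zero)
    moreover have "norm (of_real c / 2 * deriv h z) > 0"
      using c h'[OF z] by auto
    ultimately show ?thesis
      unfolding H'_def G'_def norm_mult[of "of_real c / 2 * deriv h z"] norm_mult[of "\<omega> z"]
      by (rule mult_strict_left_mono)
  qed
  have lower: "c / 2 * Re ((1 + z) / (1 - z)) \<le> Re ((1 - z)\<^sup>2 * (H' z - G' z))"
    if z: "z \<in> \<E>" for z
  proof -
    define p where "p = (1 - \<omega> z) / (2 * (1 + \<omega> z))"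
    note n2 = Re_cayley_half_pos(1)[OF \<omega>1[OF z]]
    have "2 * (1 + \<omega> z) \<noteq> 0" using n2 by (metis mult_eq_0_iff zero_neq_numeral)
    then have "p * (2 * (1 + \<omega> z)) = 1 - \<omega> z"
      unfolding p_def by (simp only: times_divide_eq_left nonzero_mult_div_cancel_right not_False_eq_True)
    then have p: "1 - \<omega> z = 2 * p * (1 + \<omega> z)" by (simp only: mult_ac)
    \<comment> \<open>By \<open>h'\<close> the weight removes \<open>deriv h z\<close>, and
      \<open>cm\<close> turns the coefficient of \<open>p\<close> into 1. Dropping the positive
      number \<open>Re p\<close> leaves the bound.\<close>
    have "(1 - z)\<^sup>2 * (H' z - G' z) = of_real c / 2 * (deriv h z * (1 - z)\<^sup>2)
        * (of_real m * (1 - \<omega> z) + X z * (1 + \<omega> z))"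
      unfolding H'_def G'_def by (simp add: algebra_simps)
    also have "\<dots> = of_real c / 2 * (deriv h z * (1 + \<omega> z) * (1 - z)\<^sup>2) * (2 * of_real m * p + X z)"
      unfolding p by (simp add: field_simps)
    also have "\<dots> = of_real c / 2 * (2 * of_real m * p + (of_nat n * p + (1 + z) / (1 - z)))"
      unfolding h'[OF z] X_def p_def by simp
    also have "of_real c / 2 * (2 * of_real m * p + (of_nat n * p + W))
        = of_real c * (of_real m + of_nat n / 2) * p + of_real (c / 2) * W" for W :: complex
      by (simp add: field_simps)
    finally have "(1 - z)\<^sup>2 * (H' z - G' z) = p + of_real (c / 2) * ((1 + z) / (1 - z))"
      unfolding cm by simp
    moreover have "Re (of_real (c / 2) * W) = c / 2 * Re W" for W
      by simp
    ultimately show ?thesis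
      using Re_cayley_half_pos(2)[OF \<omega>1[OF z], folded p_def] by (simp only: plus_complex.sel)
  qed
  have inj: "inj_on (harm H G) \<E>" and CHD: "CHD (harm H G)"
    using shear_unit_disk[OF dH dG _ lower sp] c by auto

  \<comment> \<open>The closed form is established on the disk, which suffices because
    \<open>CHD\<close> and \<open>S_H\<close> only involve values there.\<close>
  have conv: "harm_conv (h_a a) (g_a a) h g z = harm H G z" if z: "z \<in> \<E>" for z
  proof -
    have "hadamard (h_a a) h z = H z"
      unfolding H_def c_def
      by (rule hadamard_derivation[OF h_a_g_a_eq(1)[OF a] hol(1) assms(5) z])
    moreover have "hadamard (g_a a) g z = G z"
      unfolding G_def c_def
      by (rule hadamard_derivation[OF h_a_g_a_eq(2)[OF a] hol(2) assms(6) z])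
    ultimately show ?thesis by (simp add: harm_conv_def harm_def)
  qed
  have "CHD (harm_conv (h_a a) (g_a a) h g)"
    using CHD unfolding CHD_def by (simp add: conv cong: image_cong_simp)
  moreover have "(\<lambda>z. of_real (1 + a) * harm_conv (h_a a) (g_a a) h g z) \<in> S_H"
    unfolding S_H_def
  proof (intro CollectI exI conjI ballI)
    let ?H = "\<lambda>z. of_real (1 + a) * H z" and ?G = "\<lambda>z. of_real (1 + a) * G z"
    have dH1: "(?H has_field_derivative of_real (1 + a) * H' z) (at z)"
      and dG1: "(?G has_field_derivative of_real (1 + a) * G' z) (at z)" if "z \<in> \<E>" for z
      by (rule DERIV_cmult[OF dH[OF that]]) (rule DERIV_cmult[OF dG[OF that]])
    show "?H holomorphic_on \<E>" "?G holomorphic_on \<E>"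
      unfolding holomorphic_on_open[OF open_ball] using dH1 dG1 by blast+
    show "of_real (1 + a) * harm_conv (h_a a) (g_a a) h g z = harm ?H ?G z" if "z \<in> \<E>" for z
      unfolding conv[OF that] by (simp add: harm_def algebra_simps)
    show "?H 0 = 0" "?G 0 = 0" using assms(5,6) by (simp_all add: H_def G_def)
    have \<omega>0: "\<omega> 0 = 0" using n by (simp add: \<omega>_def)
    \<comment> \<open>As \<open>\<omega> 0 = 0\<close>, the value is
      \<open>(1 + c) / 2 = 1 / (1 + a)\<close>, which is why the factor \<open>1 + a\<close>
      normalizes the convolution.\<close>
    have "H' 0 = of_real (c / 2 * (m + (real n / 2 + 1)))"
      using h'[of 0] by (simp add: H'_def X_def \<omega>0)
    moreover have "(1 + a) * (c / 2 * (m + (real n / 2 + 1))) = 1"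
    proof -
      have "c / 2 * (m + (real n / 2 + 1)) = (1 + c) / 2"
        using c by (simp add: m_def field_simps)
      moreover have "(1 + a) * (1 + c) = 2" using a1 by (simp add: c_def field_simps)
      ultimately show ?thesis by simp
    qed
    ultimately show "deriv ?H 0 = 1"
      using DERIV_imp_deriv[OF dH1[of 0]] by (metis centre_in_ball of_real_1 of_real_mult zero_less_one)
    show "sense_preserving ?H ?G"
      unfolding sense_preserving_def
      using sp na by (simp add: DERIV_imp_deriv[OF dH1] DERIV_imp_deriv[OF dG1] norm_mult del: of_real_add)
    show "inj_on (\<lambda>z. of_real (1 + a) * harm_conv (h_a a) (g_a a) h g z) \<E>"
      using inj na by (auto simp: inj_on_def conv simp del: of_real_add)
  qed
  ultimately show ?thesis by blast
qed

end
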